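(* For any polynomial $S$ of degree $n$, there exists a delta operator on $\mathbb{C}_n[t]$, unique up to an $n$-th root of unity, whose binomial sequence has $S$ as highest-degree term (that is, $S_n=S$).
   Context: $S$ has complex coefficients, and $\mathbb{C}_n[t]$ is the space of complex polynomials of degree at most $n$. A delta operator on $\mathbb{C}_n[t]$ is a linear endomorphism $\mathfrak{d}$ commuting with all translations $P(t)\mapsto P(t+a)$, with $\mathfrak{d}(1)=0$ and $\mathfrak{d}(t)\neq 0$; equivalently $\mathfrak{d}=\sum_{k=1}^n a_k\,\partial^k/\partial t^k$ with $a_1\ne0$. Its binomial sequence is the unique family $(S_k)_{0\le k\le n}$ with $\deg S_k=k$, $S_0=1$, and $\mathfrak{d}S_k=kS_{k-1}$, $S_k(0)=0$ for $1\le k\le n$. "Unique up to an $n$-th root of unity" means unique up to multiplication of the operator by an $n$-th root of unity.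
   Formalization: The polynomial S is assumed to satisfy S(0)=0 and n is at least 1: a binomial sequence requires S_n(0)=0, so the claim fails for example for S=t+1, and for n=0 the condition on d(t) has no meaning. *)

theory Defs
  imports Complex_Main "HOL-Computational_Algebra.Polynomial"
begin

definition polys_upto :: "nat \<Rightarrow> complex poly set" where
  "polys_upto n = {p. degree p \<le> n}"

definition translate :: "complex \<Rightarrow> complex poly \<Rightarrow> complex poly" where
  "translate a p = pcompose p [:a, 1:]"

(* An operator on polys_upto n is represented by a function on all polynomials, of which
   only the values on polys_upto n matter; two operators are equal if they agree there. *)
definition linear_endo :: "nat \<Rightarrow> (complex poly \<Rightarrow> complex poly) \<Rightarrow> bool" where
  "linear_endo n d \<longleftrightarrow>
     (\<forall>p\<in>polys_upto n. d p \<in> polys_upto n) \<and>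
     (\<forall>p\<in>polys_upto n. \<forall>q\<in>polys_upto n. d (p + q) = d p + d q) \<and>
     (\<forall>c. \<forall>p\<in>polys_upto n. d (smult c p) = smult c (d p))"

(* Meaningful for n \<ge> 1 only: otherwise t = [:0, 1:] is not in polys_upto n. *)
definition delta_operator :: "nat \<Rightarrow> (complex poly \<Rightarrow> complex poly) \<Rightarrow> bool" where
  "delta_operator n d \<longleftrightarrow>
     linear_endo n d \<and>
     (\<forall>a. \<forall>p\<in>polys_upto n. d (translate a p) = translate a (d p)) \<and>
     d 1 = 0 \<and> d [:0, 1:] \<noteq> 0"

(* Only the terms f 0, ..., f n belong to the sequence. *)
definition binomial_sequence ::
    "nat \<Rightarrow> (complex poly \<Rightarrow> complex poly) \<Rightarrow> (nat \<Rightarrow> complex poly) \<Rightarrow> bool" where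
  "binomial_sequence n d f \<longleftrightarrow>
     (\<forall>k\<le>n. degree (f k) = k) \<and>
     f 0 = 1 \<and>
     (\<forall>k\<in>{1..n}. d (f k) = smult (of_nat k) (f (k - 1)) \<and> poly (f k) 0 = 0)"

(* A delta operator has exactly one binomial sequence, so the existential quantifier
   expresses that the top term of the binomial sequence of d is S. *)
definition delta_operator_with_top ::
    "nat \<Rightarrow> complex poly \<Rightarrow> (complex poly \<Rightarrow> complex poly) \<Rightarrow> bool" where
  "delta_operator_with_top n S d \<longleftrightarrow>
     delta_operator n d \<and> (\<exists>f. binomial_sequence n d f \<and> f n = S)"

end

theory Submission imports Defs begin

text \<open>A delta operator is \<open>d = a(D)\<close> with \<open>a = a\<^sub>1 D + a\<^sub>2 D\<^sup>2 + \<dots>\<close> and \<open>D\<close> the derivative. If \<open>S\<close> is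
  the top term of its binomial sequence, the other terms are \<open>S\<^sub>k = k! / n! \<cdot> d\<^sup>n\<^sup>-\<^sup>k S\<close>, so the
  conditions on \<open>d\<close> are \<open>(d\<^sup>j S)(0) = 0\<close> for \<open>0 < j < n\<close> and \<open>d\<^sup>n S = n!\<close>. The latter says that
  \<open>a\<^sub>1\<^sup>n\<close> is the inverse of the leading coefficient of \<open>S\<close>. Given \<open>a\<^sub>1\<close>, the condition for
  \<open>j = n - i\<close> involves only \<open>a\<^sub>1, \<dots>, a\<^sub>i\<^sub>+\<^sub>1\<close> and is linear in \<open>a\<^sub>i\<^sub>+\<^sub>1\<close> with nonzero slope, so the
  remaining coefficients are determined one after the other.\<close>

section \<open>Operators given by power series in the derivative\<close>

definition diff_op :: "'a::field_char_0 poly \<Rightarrow> 'a poly \<Rightarrow> 'a poly" where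
  "diff_op g p = (\<Sum>k\<le>degree p. smult (coeff g k) ((pderiv ^^ k) p))"

lemma smult_sum_right: "smult c (\<Sum>k\<in>A. f k) = (\<Sum>k\<in>A. smult c (f k))"
  by (induction A rule: infinite_finite_induct) (simp_all add: smult_add_right)

text \<open>Derivatives of order above \<open>degree p\<close> vanish, so polynomials of different
  degrees can share one summation bound.\<close>

lemma diff_op_extend:
  assumes "degree p \<le> N"
  shows "diff_op g p = (\<Sum>k\<le>N. smult (coeff g k) ((pderiv ^^ k) p))"
  unfolding diff_op_def
proof (rule sum.mono_neutral_left)
  show "\<forall>k\<in>{..N} - {..degree p}. smult (coeff g k) ((pderiv ^^ k) p) = 0"
  proof
    fix k assume "k \<in> {..N} - {..degree p}"
    then have k: "degree p < k" by simp
    have "(pderiv ^^ k) p = 0"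
      by (rule poly_eqI) (use k in \<open>simp add: coeff_higher_pderiv coeff_eq_0\<close>)
    then show "smult (coeff g k) ((pderiv ^^ k) p) = 0" by simp
  qed
qed (use assms in auto)

lemma diff_op_cong:
  assumes "\<And>k. k \<le> degree p \<Longrightarrow> coeff g k = coeff h k"
  shows "diff_op g p = diff_op h p"
  unfolding diff_op_def using assms by (intro sum.cong) auto

lemma diff_op_0_left [simp]: "diff_op 0 p = 0"
  and diff_op_0_right [simp]: "diff_op g 0 = 0"
  by (simp_all add: diff_op_def)

lemma diff_op_add_left: "diff_op (g + h) p = diff_op g p + diff_op h p"
  by (simp add: diff_op_def smult_add_left sum.distrib)

lemma diff_op_smult_left: "diff_op (smult c g) p = smult c (diff_op g p)"
  by (simp add: diff_op_def smult_sum_right)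

lemma diff_op_add_right: "diff_op g (p + q) = diff_op g p + diff_op g q"
proof -
  define N where "N = max (degree p) (degree q)"
  have "degree (p + q) \<le> N" by (simp add: N_def degree_add_le)
  then show ?thesis
    by (simp add: diff_op_extend[of _ N] N_def higher_pderiv_add smult_add_right sum.distrib)
qed

lemma diff_op_smult_right: "diff_op g (smult c p) = smult c (diff_op g p)"
proof -
  have "degree (smult c p) \<le> degree p" by (rule degree_smult_le)
  then show ?thesis
    by (simp add: diff_op_extend[of _ "degree p"] higher_pderiv_smult smult_sum_right mult.commute)
qed

lemma pderiv_diff_op: "pderiv (diff_op g p) = diff_op g (pderiv p)"
proof -
  have "diff_op g (pderiv p) = (\<Sum>k\<le>degree p. smult (coeff g k) ((pderiv ^^ k) (pderiv p)))"
    by (rule diff_op_extend) (simp add: degree_pderiv)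
  then show ?thesis
    using higher_pderiv_sum[where n = 1 and A = "{..degree p}"
        and f = "\<lambda>k. smult (coeff g k) ((pderiv ^^ k) p)"]
    by (simp add: diff_op_def pderiv_smult funpow_swap1)
qed

text \<open>Reading \<open>pCons c g\<close> as \<open>c + X * g\<close> isolates the constant term;
  this recursion drives the induction in the product rule below.\<close>

lemma diff_op_pCons: "diff_op (pCons c g) p = smult c p + diff_op g (pderiv p)"
proof -
  have "diff_op (pCons c g) p =
      (\<Sum>k\<le>Suc (degree p). smult (coeff (pCons c g) k) ((pderiv ^^ k) p))"
    by (rule diff_op_extend) simp
  also have "\<dots> = smult c p + (\<Sum>k\<le>degree p. smult (coeff g k) ((pderiv ^^ k) (pderiv p)))"
    by (subst sum.atMost_Suc_shift) (simp add: funpow_Suc_right del: funpow.simps)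
  also have "(\<Sum>k\<le>degree p. smult (coeff g k) ((pderiv ^^ k) (pderiv p))) = diff_op g (pderiv p)"
    by (rule diff_op_extend[symmetric]) (simp add: degree_pderiv)
  finally show ?thesis .
qed

lemma diff_op_1_left [simp]: "diff_op 1 p = p"
  by (simp add: one_pCons diff_op_pCons)

text \<open>Induction on \<open>g\<close> works because the derivative commutes with
  \<open>diff_op h\<close>. Powers of a polynomial thus act as iterates of its operator.\<close>

lemma diff_op_mult: "diff_op (g * h) p = diff_op g (diff_op h p)"
proof (induction g arbitrary: p)
  case (pCons c g)
  have "diff_op (pCons c g * h) p = smult c (diff_op h p) + diff_op (g * h) (pderiv p)"
    by (simp add: diff_op_add_left diff_op_smult_left diff_op_pCons)
  also have "\<dots> = diff_op (pCons c g) (diff_op h p)"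
    by (simp add: pCons.IH diff_op_pCons pderiv_diff_op)
  finally show ?case .
qed simp

lemma degree_diff_op_le: "degree (diff_op g p) \<le> degree p"
  unfolding diff_op_def
  by (intro degree_sum_le)
     (auto intro: order_trans[OF degree_smult_le] simp: degree_higher_pderiv)

text \<open>The constant coefficient contributes a nonzero multiple of \<open>p\<close>; everything
  else contains a derivative.\<close>

lemma degree_diff_op:
  assumes "coeff g 0 \<noteq> 0"
  shows "degree (diff_op g p) = degree p"
proof (cases g)
  case (pCons c h)
  with assms have c: "c \<noteq> 0" by simp
  show ?thesis
  proof (cases "degree p = 0")
    case True
    then have "pderiv p = 0" by (simp add: pderiv_eq_0_iff)
    then show ?thesis using c by (simp add: pCons diff_op_pCons)
  next
    case False
    have "degree (diff_op h (pderiv p)) \<le> degree (pderiv p)" by (rule degree_diff_op_le)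
    also have "\<dots> < degree (smult c p)" using False c by (simp add: degree_pderiv)
    finally show ?thesis using c by (simp add: pCons diff_op_pCons degree_add_eq_left)
  qed
qed

text \<open>Each application differentiates once and then applies \<open>diff_op u\<close>, which
  keeps the degree. Truncated subtraction covers \<open>j\<close> beyond the degree.\<close>

lemma degree_diff_op_pCons_0_power:
  assumes "coeff u 0 \<noteq> 0"
  shows "degree (diff_op (pCons 0 u ^ j) p) = degree p - j"
proof (induction j)
  case (Suc j)
  then show ?case
    using assms by (simp only: power_Suc diff_op_mult)
      (simp add: diff_op_pCons degree_diff_op degree_pderiv)
qed simp

lemma poly_diff_op_0:
  "poly (diff_op g p) 0 = (\<Sum>k\<le>degree p. coeff g k * fact k * coeff p k)"
  unfolding diff_op_def poly_sum
  by (simp add: poly_0_coeff_0 coeff_higher_pderiv pochhammer_fact mult.assoc)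

section \<open>Translations and Taylor coefficients\<close>

lemma higher_pderiv_translate: "(pderiv ^^ k) (translate a p) = translate a ((pderiv ^^ k) p)"
proof (induction k)
  case (Suc k)
  then show ?case
    by (simp add: translate_def pderiv_pcompose pderiv_pCons)
qed simp

lemma degree_translate [simp]: "degree (translate a p) = degree p"
  by (simp add: translate_def degree_pcompose)

lemma poly_translate [simp]: "poly (translate a p) x = poly p (a + x)"
  by (simp add: translate_def poly_pcompose)

lemma translate_diff_op: "translate a (diff_op g p) = diff_op g (translate a p)"
proof -
  have "diff_op g (translate a p) = (\<Sum>k\<le>degree p. smult (coeff g k) (translate a ((pderiv ^^ k) p)))"
    by (simp add: diff_op_def higher_pderiv_translate)
  then show ?thesis
    by (simp add: diff_op_def translate_def pcompose_sum pcompose_smult)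
qed

text \<open>Taylor's formula: higher derivatives commute with translation, so their values at
  \<open>0\<close> on the translate are their values at \<open>a\<close> on
  \<open>p\<close>.\<close>

lemma coeff_translate: "coeff (translate a p) k = poly ((pderiv ^^ k) p) a / fact k"
proof -
  have "fact k * coeff (translate a p) k = poly ((pderiv ^^ k) (translate a p)) 0"
    by (simp add: poly_0_coeff_0 coeff_higher_pderiv pochhammer_fact)
  also have "\<dots> = poly ((pderiv ^^ k) p) a"
    by (simp add: higher_pderiv_translate)
  finally show ?thesis by (simp add: field_simps)
qed

section \<open>Delta operators as series in the derivative\<close>

text \<open>Linearity is given only on \<open>polys_upto n\<close>, so the induction also checks
  that partial sums stay in that space.\<close>

lemma linear_endo_sum:
  assumes "linear_endo n d" "finite A" "\<And>k. k \<in> A \<Longrightarrow> q k \<in> polys_upto n"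
  shows "d (\<Sum>k\<in>A. smult (c k) (q k)) = (\<Sum>k\<in>A. smult (c k) (d (q k)))"
  using assms(2,3)
proof (induction A rule: finite_induct)
  case empty
  have "0 \<in> polys_upto n" by (simp add: polys_upto_def)
  then have "d (smult 0 0) = smult 0 (d 0)"
    using assms(1) unfolding linear_endo_def by blast
  then show ?case by simp
next
  case (insert x A)
  have 1: "smult (c k) (q k) \<in> polys_upto n" if "k \<in> insert x A" for k
    using insert.prems[OF that] by (auto simp: polys_upto_def intro: order_trans[OF degree_smult_le])
  have 2: "(\<Sum>k\<in>A. smult (c k) (q k)) \<in> polys_upto n"
    using 1 insert.hyps by (auto simp: polys_upto_def intro!: degree_sum_le)
  have "d (smult (c x) (q x) + (\<Sum>k\<in>A. smult (c k) (q k))) =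
      d (smult (c x) (q x)) + d (\<Sum>k\<in>A. smult (c k) (q k))"
    using assms(1) 1 2 unfolding linear_endo_def by blast
  moreover have "d (smult (c x) (q x)) = smult (c x) (d (q x))"
    using assms(1) insert.prems unfolding linear_endo_def by blast
  ultimately show ?case using insert by simp
qed

text \<open>Taylor's formula turns \<open>(d p)(x) = (d (translate x p))(0)\<close> into an expansion of \<open>d\<close>
  in powers of the derivative, with coefficients \<open>(d t\<^sup>k)(0) / k!\<close>.\<close>

lemma delta_operator_imp_diff_op:
  assumes d: "delta_operator n d" and n: "n \<ge> 1"
  obtains u where "coeff u 0 \<noteq> 0" "\<And>p. p \<in> polys_upto n \<Longrightarrow> d p = diff_op (pCons 0 u) p"
proof -
  have lin: "linear_endo n d"
    and trans: "\<And>a p. p \<in> polys_upto n \<Longrightarrow> d (translate a p) = translate a (d p)"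
    and d1: "d 1 = 0" and dt: "d [:0, 1:] \<noteq> 0"
    using d by (auto simp: delta_operator_def)
  define g where "g = (\<Sum>k\<le>n. monom (poly (d (monom 1 k)) 0 / fact k) k)"
  have coeff_g: "coeff g k = poly (d (monom 1 k)) 0 / fact k" if "k \<le> n" for k
    using that by (simp add: g_def coeff_sum)
  have rep: "d p = diff_op g p" if p: "p \<in> polys_upto n" for p
  proof (rule iffD1[OF poly_eq_poly_eq_iff], rule ext)
    fix x
    have deg: "degree p \<le> n" using p by (simp add: polys_upto_def)
    have "poly (d p) x = poly (d (translate x p)) 0" using trans[OF p] by simp
    also have "translate x p = (\<Sum>k\<le>n. smult (coeff (translate x p) k) (monom 1 k))"
      using poly_as_sum_of_monoms'[of "translate x p" n] deg by (simp add: smult_monom)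
    also have "d \<dots> = (\<Sum>k\<le>n. smult (coeff (translate x p) k) (d (monom 1 k)))"
      by (rule linear_endo_sum[OF lin]) (auto simp: polys_upto_def degree_monom_eq)
    also have "poly \<dots> 0 = poly (diff_op g p) x"
      by (auto simp: diff_op_extend[OF deg] poly_sum coeff_translate coeff_g intro!: sum.cong)
    finally show "poly (d p) x = poly (diff_op g p) x" .
  qed
  obtain c u where g: "g = pCons c u" by (cases g)
  \<comment> \<open>The constant coefficient of \<open>g\<close> is the value of \<open>d 1\<close>
    at \<open>0\<close>.\<close>
  have "c = 0"
    using coeff_g[of 0] d1 by (simp add: g)
  \<comment> \<open>On \<open>t\<close> the series acts through its linear coefficient alone:
    \<open>d t\<close> is the constant \<open>coeff u 0\<close>.\<close>
  moreover have "d [:0, 1:] = diff_op g [:0, 1:]"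
    using n by (intro rep) (simp add: polys_upto_def)
  then have "diff_op (pCons c u) [:0, 1:] \<noteq> 0" using dt g by simp
  then have "coeff u 0 \<noteq> 0"
    using \<open>c = 0\<close> by (cases u) (auto simp: diff_op_pCons pderiv_pCons)
  ultimately show thesis using that rep g by blast
qed

lemma delta_operator_diff_op:
  assumes "coeff u 0 \<noteq> 0" and eq: "\<And>p. p \<in> polys_upto n \<Longrightarrow> d p = diff_op (pCons 0 u) p"
    and n: "n \<ge> 1"
  shows "delta_operator n d"
proof -
  have lin: "linear_endo n d"
    unfolding linear_endo_def
    by (auto simp: eq polys_upto_def degree_add_le diff_op_add_right diff_op_smult_right
        intro: order_trans[OF degree_diff_op_le] order_trans[OF degree_smult_le])
  have tr: "d (translate a p) = translate a (d p)" if "p \<in> polys_upto n" for a p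
  proof -
    have "translate a p \<in> polys_upto n" using that by (simp add: polys_upto_def)
    then show ?thesis using that by (simp add: eq translate_diff_op)
  qed
  have d1: "d 1 = 0"
    by (subst eq) (simp_all add: polys_upto_def diff_op_pCons)
  have "d [:0, 1:] = diff_op u 1"
    using n by (subst eq) (simp_all add: polys_upto_def diff_op_pCons pderiv_pCons one_pCons)
  then have dt: "d [:0, 1:] \<noteq> 0"
    using assms(1) by (cases u) (auto simp: diff_op_pCons)
  show ?thesis
    unfolding delta_operator_def using lin tr d1 dt by blast
qed

section \<open>Binomial sequences as conditions on coefficients\<close>

lemma coeff_pCons_0_power: "coeff (pCons 0 u ^ j) k = (if k < j then 0 else coeff (u ^ j) (k - j))"
proof -
  have "pCons 0 u = monom 1 1 * u" by (simp add: monom_Suc)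
  then have "pCons 0 u ^ j = monom 1 j * u ^ j"
    by (simp add: power_mult_distrib monom_power)
  then show ?thesis by (simp add: coeff_monom_mult)
qed

text \<open>\<open>X^n\<close> divides \<open>pCons 0 u ^ n\<close> and \<open>S\<close> has degree
  \<open>n\<close>, so only the \<open>n\<close>-th derivative of \<open>S\<close> survives.\<close>

lemma poly_diff_op_power_degree:
  assumes "degree S = n"
  shows "poly (diff_op (pCons 0 u ^ n) S) 0 = coeff u 0 ^ n * (fact n * coeff S n)"
proof -
  have "poly (diff_op (pCons 0 u ^ n) S) 0 =
      (\<Sum>k\<le>n. coeff (pCons 0 u ^ n) k * fact k * coeff S k)"
    by (simp add: poly_diff_op_0 assms)
  also have "\<dots> = (\<Sum>k\<le>n. if k = n then coeff u 0 ^ n * (fact n * coeff S n) else 0)"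
    by (intro sum.cong) (auto simp: coeff_pCons_0_power coeff_0_power)
  finally show ?thesis by simp
qed

text \<open>The operator is \<open>a(D)\<close> with \<open>a = pCons 0 u\<close>, that is, \<open>coeff u i = a\<^sub>i\<^sub>+\<^sub>1\<close>.\<close>

definition top_condition :: "nat \<Rightarrow> complex poly \<Rightarrow> complex poly \<Rightarrow> bool" where
  "top_condition n S u \<longleftrightarrow> coeff u 0 ^ n * coeff S n = 1 \<and>
     (\<forall>j\<in>{1..<n}. poly (diff_op (pCons 0 u ^ j) S) 0 = 0)"

lemma top_conditionI_binomial:
  assumes b: "binomial_sequence n d f" and top: "f n = S" and n: "n \<ge> 1"
    and eq: "\<And>p. p \<in> polys_upto n \<Longrightarrow> d p = diff_op (pCons 0 u) p"
  shows "top_condition n S u"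
proof -
  have deg: "degree (f k) = k" if "k \<le> n" for k
    using b that by (simp add: binomial_sequence_def)
  have f0: "f 0 = 1" using b by (simp add: binomial_sequence_def)
  have step: "d (f k) = smult (of_nat k) (f (k - 1))" and zero: "poly (f k) 0 = 0"
    if "k \<ge> 1" "k \<le> n" for k
    using b that by (auto simp: binomial_sequence_def)
  \<comment> \<open>The recursion for \<open>d (f k)\<close> is unrolled downwards from
    \<open>f n = S\<close>; factorials on both sides avoid division.\<close>
  have iter: "smult (fact (n - j)) (diff_op (pCons 0 u ^ j) S) = smult (fact n) (f (n - j))"
    if "j \<le> n" for j
    using that
  proof (induction j)
    case 0
    then show ?case using top by simp
  next
    case (Suc j)
    define k where "k = n - Suc j"
    have k: "n - j = Suc k" "Suc k \<le> n" using Suc.prems by (auto simp: k_def)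
    have pos: "of_nat (Suc k) \<noteq> (0::complex)" by (simp only: of_nat_eq_0_iff nat.simps not_False_eq_True)
    have fin: "f (Suc k) \<in> polys_upto n" using deg[of "Suc k"] k by (simp add: polys_upto_def)
    have "smult (of_nat (Suc k)) (smult (fact k) (diff_op (pCons 0 u ^ Suc j) S)) =
        diff_op (pCons 0 u) (smult (fact (n - j)) (diff_op (pCons 0 u ^ j) S))"
      by (simp only: k diff_op_mult diff_op_smult_right power_Suc fact_Suc smult_smult)
    also have "\<dots> = smult (fact n) (d (f (Suc k)))"
      using Suc fin by (simp add: k eq diff_op_smult_right)
    also have "\<dots> = smult (of_nat (Suc k)) (smult (fact n) (f k))"
      using step[of "Suc k"] k by (simp add: mult.commute)
    finally show ?case using pos unfolding k_def[symmetric] by (metis smult_cancel)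
  qed
  have "poly (diff_op (pCons 0 u ^ j) S) 0 = 0" if "j \<in> {1..<n}" for j
    using arg_cong[OF iter[of j], of "\<lambda>p. poly p 0"] zero[of "n - j"] that by auto
  \<comment> \<open>The case \<open>j = n\<close> meets \<open>f 0 = 1\<close>, which yields the
    normalization of \<open>coeff u 0\<close>.\<close>
  moreover have "coeff u 0 ^ n * coeff S n = 1"
    using arg_cong[OF iter[of n], of "\<lambda>p. poly p 0"]
      poly_diff_op_power_degree[of S n u] top deg[of n] f0 by auto
  ultimately show ?thesis by (auto simp: top_condition_def)
qed

lemma binomial_sequence_of_top_condition:
  assumes t: "top_condition n S u" and S: "degree S = n" "poly S 0 = 0" and n: "n \<ge> 1"
    and eq: "\<And>p. p \<in> polys_upto n \<Longrightarrow> d p = diff_op (pCons 0 u) p"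
  shows "\<exists>f. binomial_sequence n d f \<and> f n = S"
proof -
  have u0: "coeff u 0 \<noteq> 0"
    using t n by (auto simp: top_condition_def zero_power)
  define f where "f = (\<lambda>k. smult (fact k / fact n) (diff_op (pCons 0 u ^ (n - k)) S))"
  have deg: "degree (f k) = k" if "k \<le> n" for k
    using that by (simp add: f_def degree_diff_op_pCons_0_power[OF u0] S)
  have fn: "f n = S" by (simp add: f_def)
  have "poly (f 0) 0 = 1"
    using poly_diff_op_power_degree[OF S(1), of u] t by (simp add: f_def top_condition_def)
  then have f0: "f 0 = 1"
    using deg[of 0] by (auto elim!: degree_eq_zeroE simp: one_pCons)
  have "d (f k) = smult (of_nat k) (f (k - 1)) \<and> poly (f k) 0 = 0" if k: "k \<in> {1..n}" for k
  proof
    obtain m where m: "k = Suc m" using k by (cases k) auto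
    then have nk: "n - m = Suc (n - k)" using k by auto
    have "f k \<in> polys_upto n" using deg[of k] k by (simp add: polys_upto_def)
    then have "d (f k) = smult (fact k / fact n) (diff_op (pCons 0 u ^ Suc (n - k)) S)"
      by (simp only: eq) (simp only: f_def diff_op_smult_right diff_op_mult power_Suc)
    then show "d (f k) = smult (of_nat k) (f (k - 1))"
      by (simp add: f_def m nk[unfolded m] del: power_Suc)
    show "poly (f k) 0 = 0"
    \<comment> \<open>For \<open>k = n\<close> the exponent is \<open>0\<close>, outside the range
      of \<open>top_condition\<close>; there the vanishing is the assumption on \<open>S\<close>
      itself.\<close>
    proof (cases "k = n")
      case True
      then show ?thesis using fn S by simp
    next
      case False
      then have "n - k \<in> {1..<n}" using k by auto
      then show ?thesis using t by (simp add: f_def top_condition_def)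
    qed
  qed
  then have "binomial_sequence n d f"
    using deg f0 by (simp add: binomial_sequence_def)
  then show ?thesis using fn by blast
qed

text \<open>Reduces the theorem to polynomial equations for the coefficients of
  \<open>u\<close>.\<close>

lemma delta_operator_with_top_iff:
  assumes "n \<ge> 1" "degree S = n" "poly S 0 = 0"
  shows "delta_operator_with_top n S d \<longleftrightarrow>
    (\<exists>u. top_condition n S u \<and> (\<forall>p\<in>polys_upto n. d p = diff_op (pCons 0 u) p))"
proof
  assume L: "delta_operator_with_top n S d"
  then obtain u where "\<And>p. p \<in> polys_upto n \<Longrightarrow> d p = diff_op (pCons 0 u) p"
    using delta_operator_imp_diff_op assms(1) unfolding delta_operator_with_top_def by metis
  then show "\<exists>u. top_condition n S u \<and> (\<forall>p\<in>polys_upto n. d p = diff_op (pCons 0 u) p)"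
    using L top_conditionI_binomial[of n d _ S u] assms(1)
    unfolding delta_operator_with_top_def by blast
next
  assume "\<exists>u. top_condition n S u \<and> (\<forall>p\<in>polys_upto n. d p = diff_op (pCons 0 u) p)"
  then obtain u where u: "top_condition n S u" "\<And>p. p \<in> polys_upto n \<Longrightarrow> d p = diff_op (pCons 0 u) p"
    by blast
  have "coeff u 0 \<noteq> 0" using u(1) assms(1) by (auto simp: top_condition_def zero_power)
  then show "delta_operator_with_top n S d"
    unfolding delta_operator_with_top_def
    using delta_operator_diff_op binomial_sequence_of_top_condition[OF u(1) assms(2,3,1)] u(2) assms(1)
    by blast
qed

section \<open>Effect of changing one coefficient\<close>

text \<open>If \<open>v - u\<close> is \<open>X^i * r\<close>, then \<open>v^j - u^j\<close> is
  \<open>X^i * r\<close> times the sum of the \<open>u^(j-1-m) * v^m\<close>. As \<open>u\<close>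
  and \<open>v\<close> share their constant coefficient, that sum has constant term
  \<open>j * coeff u 0 ^ (j-1)\<close>.\<close>

lemma coeff_power_diff:
  fixes u v :: "'a::comm_ring_1 poly"
  assumes i: "i \<ge> 1" and agree: "\<forall>k<i. coeff v k = coeff u k"
  shows "k < i \<Longrightarrow> coeff (v ^ j) k = coeff (u ^ j) k"
    and "coeff (v ^ j) i = coeff (u ^ j) i + of_nat j * coeff u 0 ^ (j - 1) * (coeff v i - coeff u i)"
proof -
  have "monom 1 i dvd v - u" using agree by (simp add: monom_1_dvd_iff')
  then obtain r where r: "v - u = monom 1 i * r" by (rule dvdE)
  define s where "s = r * (\<Sum>m<j. u ^ (j - Suc m) * v ^ m)"
  have vu: "v ^ j = u ^ j + monom 1 i * s"
    using power_diff_sumr2[of v j u] by (simp add: r s_def algebra_simps)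
  show "k < i \<Longrightarrow> coeff (v ^ j) k = coeff (u ^ j) k"
    by (simp add: vu coeff_monom_mult)
  have ri: "coeff v i - coeff u i = coeff r 0"
    using arg_cong[OF r, of "\<lambda>p. coeff p i"] by (simp add: coeff_monom_mult)
  have v0: "coeff v 0 = coeff u 0" using agree i by simp
  have "coeff s 0 = coeff r 0 * (\<Sum>m<j. coeff u 0 ^ (j - Suc m) * coeff u 0 ^ m)"
    by (simp add: s_def coeff_mult_0 coeff_sum coeff_0_power v0)
  also have "\<dots> = coeff r 0 * (\<Sum>m<j. coeff u 0 ^ (j - 1))"
    by (intro arg_cong2[where f = "(*)"] sum.cong) (auto simp flip: power_add)
  finally show "coeff (v ^ j) i =
      coeff (u ^ j) i + of_nat j * coeff u 0 ^ (j - 1) * (coeff v i - coeff u i)"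
    by (simp add: vu coeff_monom_mult ri mult.assoc mult.left_commute)
qed

text \<open>The factor \<open>X^j\<close> moves the first possible disagreement to index
  \<open>i + j\<close>, while evaluation on \<open>S\<close> at \<open>0\<close> sees only indices
  up to \<open>n\<close>.\<close>

lemma poly_diff_op_power_step:
  assumes S: "degree S = n" and i: "i \<ge> 1" and agree: "\<forall>k<i. coeff v k = coeff u k"
  shows "n < i + j \<Longrightarrow> poly (diff_op (pCons 0 v ^ j) S) 0 = poly (diff_op (pCons 0 u ^ j) S) 0"
    and "n = i + j \<Longrightarrow> poly (diff_op (pCons 0 v ^ j) S) 0 = poly (diff_op (pCons 0 u ^ j) S) 0 +
      of_nat j * coeff u 0 ^ (j - 1) * (coeff v i - coeff u i) * (fact n * coeff S n)"
proof -
  have low: "coeff (pCons 0 v ^ j) k = coeff (pCons 0 u ^ j) k" if "k < i + j" for k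
    using that coeff_power_diff(1)[OF i agree] by (auto simp: coeff_pCons_0_power)
  show "poly (diff_op (pCons 0 v ^ j) S) 0 = poly (diff_op (pCons 0 u ^ j) S) 0" if "n < i + j"
    using that by (simp add: poly_diff_op_0 S low)
  show "poly (diff_op (pCons 0 v ^ j) S) 0 = poly (diff_op (pCons 0 u ^ j) S) 0 +
      of_nat j * coeff u 0 ^ (j - 1) * (coeff v i - coeff u i) * (fact n * coeff S n)"
    if n: "n = i + j"
  proof -
    have split: "poly (diff_op g S) 0 =
        (\<Sum>k<n. coeff g k * fact k * coeff S k) + coeff g n * fact n * coeff S n" for g
      by (simp add: poly_diff_op_0 S lessThan_Suc_atMost[symmetric])
    have "coeff (pCons 0 v ^ j) n =
        coeff (pCons 0 u ^ j) n + of_nat j * coeff u 0 ^ (j - 1) * (coeff v i - coeff u i)"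
      using n coeff_power_diff(2)[OF i agree, of j] by (simp add: coeff_pCons_0_power)
    moreover have "(\<Sum>k<n. coeff (pCons 0 v ^ j) k * fact k * coeff S k) =
        (\<Sum>k<n. coeff (pCons 0 u ^ j) k * fact k * coeff S k)"
      using low n by simp
    ultimately show ?thesis
      unfolding split by (simp only: distrib_right mult.assoc add.assoc)
  qed
qed

section \<open>Solving the conditions\<close>

lemma top_condition_unique:
  assumes S: "degree S = n" and u: "top_condition n S u" and v: "top_condition n S v"
    and n: "n \<ge> 1" and eq0: "coeff v 0 = coeff u 0"
  shows "i < n \<Longrightarrow> coeff v i = coeff u i"
proof (induction i rule: less_induct)
  case (less i)
  show ?case
  proof (cases "i = 0")
    case True
    then show ?thesis using eq0 by simp
  next
    case False
    have u0: "coeff u 0 \<noteq> 0" and Sn: "coeff S n \<noteq> 0"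
      using u n by (auto simp: top_condition_def zero_power)
    have agree: "\<forall>k<i. coeff v k = coeff u k" using less by auto
    \<comment> \<open>Comparing condition \<open>j = n - i\<close> for \<open>u\<close> and for
      \<open>v\<close> leaves only the slope times \<open>coeff v i - coeff u i\<close>.\<close>
    have "n - i \<in> {1..<n}" using False less.prems by auto
    then have "of_nat (n - i) * coeff u 0 ^ (n - i - 1) * (coeff v i - coeff u i)
        * (fact n * coeff S n) = 0"
      using poly_diff_op_power_step(2)[OF S _ agree, of "n - i"] u v False less.prems
      by (simp add: top_condition_def)
    then show ?thesis using u0 Sn less.prems by simp
  qed
qed

lemma top_condition_exists:
  assumes S: "degree S = n" and n: "n \<ge> 1"
  shows "\<exists>u. top_condition n S u"
proof -
  have Sn: "coeff S n \<noteq> 0" using S n by auto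
  \<comment> \<open>An \<open>n\<close>-th root of \<open>1 / coeff S n\<close>, taken in polar
    form.\<close>
  define c where "c = root n (norm (1 / coeff S n)) * cis (Arg (1 / coeff S n) / n)"
  have "c ^ n = of_real (root n (norm (1 / coeff S n)) ^ n) * cis (Arg (1 / coeff S n))"
    unfolding c_def using n by (simp add: power_mult_distrib DeMoivre del: real_root_pow_pos2 flip: of_real_power)
  also have "root n (norm (1 / coeff S n)) ^ n = norm (1 / coeff S n)" using n by simp
  also have "of_real \<dots> * cis (Arg (1 / coeff S n)) = 1 / coeff S n"
    using rcis_cmod_Arg[of "1 / coeff S n"] by (simp add: rcis_def)
  finally have c: "c ^ n * coeff S n = 1" using Sn by simp
  then have c0: "c \<noteq> 0" using n by (auto simp: zero_power)
  \<comment> \<open>Induction on the number \<open>i\<close> of conditions solved, from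
    \<open>j = n - 1\<close> downwards, with \<open>coeff u 0\<close> kept equal to
    \<open>c\<close>.\<close>
  have "\<exists>u. coeff u 0 = c \<and> (\<forall>j. n - i \<le> j \<and> j < n \<longrightarrow> poly (diff_op (pCons 0 u ^ j) S) 0 = 0)"
    if "i < n" for i
    using that
  proof (induction i)
    case 0
    show ?case by (rule exI[of _ "[:c:]"]) auto
  next
    case (Suc i)
    then obtain u where u0: "coeff u 0 = c"
      and u: "\<And>j. n - i \<le> j \<Longrightarrow> j < n \<Longrightarrow> poly (diff_op (pCons 0 u ^ j) S) 0 = 0"
      by auto
    define m where "m = n - Suc i"
    have m: "n = Suc i + m" "m \<ge> 1" using Suc.prems by (auto simp: m_def)
    \<comment> \<open>\<open>K\<close> is the slope of condition \<open>m\<close> in the coefficient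
      of index \<open>Suc i\<close>, and \<open>x\<close> is the correction that makes this
      condition hold.\<close>
    define K where "K = of_nat m * c ^ (m - 1) * (fact n * coeff S n)"
    have K: "K \<noteq> 0" using m(2) c0 Sn by (simp add: K_def)
    define x where "x = - poly (diff_op (pCons 0 u ^ m) S) 0 / K"
    define v where "v = u + monom x (Suc i)"
    have agree: "\<forall>k<Suc i. coeff v k = coeff u k" by (simp add: v_def)
    have "poly (diff_op (pCons 0 v ^ j) S) 0 = 0" if j: "m \<le> j" "j < n" for j
    proof (cases "j = m")
      case True
      have "poly (diff_op (pCons 0 v ^ m) S) 0 = poly (diff_op (pCons 0 u ^ m) S) 0 + K * x"
        using poly_diff_op_power_step(2)[OF S _ agree m(1)]
        by (simp add: v_def u0 K_def mult_ac)
      then show ?thesis using K True by (simp add: x_def)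
    next
      \<comment> \<open>Here \<open>Suc i + j\<close> exceeds \<open>n\<close>, so the correction
        leaves the conditions already solved intact.\<close>
      case False
      then show ?thesis
        using poly_diff_op_power_step(1)[OF S _ agree, of j] u[of j] j m by simp
    qed
    moreover have "coeff v 0 = c" by (simp add: v_def u0)
    ultimately show ?case unfolding m_def by blast
  qed
  from this[of "n - 1"] n obtain u where "coeff u 0 = c"
    and "\<forall>j. 1 \<le> j \<and> j < n \<longrightarrow> poly (diff_op (pCons 0 u ^ j) S) 0 = 0"
    by auto
  then have "top_condition n S u" using c by (simp add: top_condition_def)
  then show ?thesis ..
qed

text \<open>The \<open>j\<close>-th power is multiplied by \<open>\<omega> ^ j\<close>: zeros stay
  zeros, and at \<open>j = n\<close> the factor is \<open>1\<close>.\<close>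

lemma top_condition_smult:
  assumes "top_condition n S u" and "\<omega> ^ n = 1"
  shows "top_condition n S (smult \<omega> u)"
proof -
  have "pCons 0 (smult \<omega> u) ^ j = smult (\<omega> ^ j) (pCons 0 u ^ j)" for j
    using smult_power[of \<omega> "pCons 0 u" j] by simp
  then show ?thesis
    using assms by (simp add: top_condition_def power_mult_distrib diff_op_smult_left)
qed

text \<open>For \<open>n \<ge> 1\<close> the top term of a binomial sequence vanishes at
  \<open>0\<close>, whence the condition on \<open>poly S 0\<close>.\<close>

theorem proposition2p18:
  fixes S :: "complex poly" and n :: nat
  assumes "n \<ge> 1" and "degree S = n" and "poly S 0 = 0"
  shows "\<exists>d. delta_operator_with_top n S d \<and>
           (\<forall>d'. delta_operator_with_top n S d' \<longleftrightarrow>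
              (\<exists>\<omega>::complex. \<omega> ^ n = 1 \<and> (\<forall>p\<in>polys_upto n. d' p = smult \<omega> (d p))))"
proof -
  note top_iff = delta_operator_with_top_iff[OF assms]
  obtain u where u: "top_condition n S u"
    using top_condition_exists assms by blast
  then have u0: "coeff u 0 \<noteq> 0"
    using assms(1) by (auto simp: top_condition_def zero_power)
  have scale: "diff_op (pCons 0 (smult \<omega> u)) p = smult \<omega> (diff_op (pCons 0 u) p)" for \<omega> p
    using diff_op_smult_left[of \<omega> "pCons 0 u" p] by simp
  show ?thesis
  proof (intro exI[of _ "diff_op (pCons 0 u)"] conjI allI iffI)
    show "delta_operator_with_top n S (diff_op (pCons 0 u))"
      using u by (auto simp: top_iff)
  next
    fix d' assume "delta_operator_with_top n S d'"
    then obtain v where v: "top_condition n S v"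
      and d': "\<forall>p\<in>polys_upto n. d' p = diff_op (pCons 0 v) p"
      by (auto simp: top_iff)
    \<comment> \<open>The ratio of the two linear coefficients; both have \<open>n\<close>-th power
      \<open>1 / coeff S n\<close>.\<close>
    define \<omega> where "\<omega> = coeff v 0 / coeff u 0"
    have Sn: "coeff S n \<noteq> 0" using u by (auto simp: top_condition_def)
    have "coeff v 0 ^ n * coeff S n = coeff u 0 ^ n * coeff S n"
      using u v by (simp add: top_condition_def)
    then have \<omega>: "\<omega> ^ n = 1"
      using Sn u0 by (simp add: \<omega>_def power_divide)
    \<comment> \<open>Uniqueness is applied to \<open>v\<close> and the rescaled solution
      \<open>smult \<omega> u\<close>, which has the same constant coefficient.\<close>
    have "coeff v i = coeff (smult \<omega> u) i" if "i < n" for i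
      using top_condition_unique[OF assms(2) top_condition_smult[OF u \<omega>] v assms(1) _ that] u0
      by (simp add: \<omega>_def)
    \<comment> \<open>Prepending \<open>0\<close> shifts indices by one, so agreement below
      \<open>n\<close> covers every coefficient seen in degree at most \<open>n\<close>.\<close>
    then have "diff_op (pCons 0 v) p = diff_op (pCons 0 (smult \<omega> u)) p" if "p \<in> polys_upto n" for p
      using that by (intro diff_op_cong) (auto simp: polys_upto_def coeff_pCons split: nat.splits)
    then show "\<exists>\<omega>. \<omega> ^ n = 1 \<and> (\<forall>p\<in>polys_upto n. d' p = smult \<omega> (diff_op (pCons 0 u) p))"
      using \<omega> d' scale by auto
  next
    fix d' assume "\<exists>\<omega>. \<omega> ^ n = 1 \<and> (\<forall>p\<in>polys_upto n. d' p = smult \<omega> (diff_op (pCons 0 u) p))"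
    then obtain \<omega> where "\<omega> ^ n = 1" "\<forall>p\<in>polys_upto n. d' p = diff_op (pCons 0 (smult \<omega> u)) p"
      using scale by auto
    then show "delta_operator_with_top n S d'"
      using top_condition_smult[OF u] by (auto simp: top_iff)
  qed
qed

end
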